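(* Let $A\in\mathbb{R}^{n\times n}$ be invertible, let $U,V\in\mathbb{R}^{n\times k}$ have full column rank, assume $I+V^TA^{-1}U$ is invertible, and let $B=A+UV^T$. Let $\widetilde{A}^{-1}\in\mathbb{R}^{n\times n}$ and $Z^{-1}\in\mathbb{R}^{k\times k}$ be approximate inverses with errors $\epsilon_1=\|\widetilde{A}^{-1}-A^{-1}\|_2$ and $\epsilon_2=\|Z^{-1}-(I+V^T\widetilde{A}^{-1}U)^{-1}\|_2$, where $I+V^T\widetilde{A}^{-1}U$ is invertible, and let $\lambda=\|U\|_2\|V\|_2$. Assume that: (i) $\|I+V^TA^{-1}U\|_2\le\beta$; (ii) the matrices $\widetilde{A}^{-1}$ and $Z^{-1}$ are invertible, and $(Z^{-1})^{-1}-V^T\widetilde{A}^{-1}U$ is invertible; (iii) $\epsilon_1<\dfrac{1}{2\|A\|_2}$; (iv) $\epsilon_2<\dfrac{1}{2(\beta+\lambda\epsilon_1)}$; (v) $2(\beta+\lambda\epsilon_1)^2\epsilon_2<\dfrac12$. Then $$\left\|B-\left(\widetilde{A}^{-1}-\widetilde{A}^{-1}UZ^{-1}V^T\widetilde{A}^{-1}\right)^{-1}\right\|_2\le 2\epsilon_1\|A\|_2^2+4\lambda\epsilon_2(\beta+\lambda\epsilon_1)^2.$$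
   Context: $\|\cdot\|_2$ is the spectral norm and $I$ is the identity matrix of appropriate size. $\widetilde{A}^{-1}$ is a single symbol for a given $n\times n$ matrix (the computed approximation of $A^{-1}$), and $Z^{-1}$ is a single symbol for a given $k\times k$ matrix (the computed approximation of $(I+V^T\widetilde{A}^{-1}U)^{-1}$); $(Z^{-1})^{-1}$ is the inverse of the latter matrix. *)

theory Defs
  imports "HOL-Analysis.Analysis"
begin

(* The library norm on real ^ 'n ^ 'm is the Frobenius norm; the spectral norm is the operator norm
   induced by the Euclidean norms on real ^ 'n and real ^ 'm. *)
abbreviation spectral_norm :: "real ^ 'n ^ 'm \<Rightarrow> real"
  where "spectral_norm M \<equiv> onorm (\<lambda>x. M *v x)"

end

theory Submission
  imports Defs
begin

(* Woodbury's identity turns the inverse of the approximate Sherman-Morrison-Woodbury formula into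
   C + U M^-1 V^T, where C = Atinv^-1 and M = Zinv^-1 - V^T Atinv U. Hence the error splits into
   (A - C) + U (I - M^-1) V^T. Three uses of one perturbation bound for inverses finish the proof:
   for A - C, for M - I = Zinv^-1 - (I + V^T Atinv U), and then for I - M^-1. *)

lemma spectral_norm_mult:
  fixes X :: "real ^ 'm ^ 'n" and Y :: "real ^ 'k ^ 'm"
  shows "spectral_norm (X ** Y) \<le> spectral_norm X * spectral_norm Y"
  using onorm_compose[OF matrix_vector_mul_bounded_linear matrix_vector_mul_bounded_linear, of X Y]
  by (simp add: o_def matrix_vector_mul_assoc)

lemma spectral_norm_add:
  fixes X Y :: "real ^ 'm ^ 'n"
  shows "spectral_norm (X + Y) \<le> spectral_norm X + spectral_norm Y"
  using onorm_triangle[OF matrix_vector_mul_bounded_linear matrix_vector_mul_bounded_linear, of X Y]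
  by (simp add: matrix_vector_mult_add_rdistrib)

lemma spectral_norm_minus_commute:
  fixes X Y :: "real ^ 'm ^ 'n"
  shows "spectral_norm (X - Y) = spectral_norm (Y - X)"
  unfolding matrix_vector_mult_diff_rdistrib onorm_def by (simp add: norm_minus_commute)

lemma spectral_norm_nonneg: "0 \<le> spectral_norm (X :: real ^ 'm ^ 'n)"
  by (rule onorm_pos_le[OF matrix_vector_mul_bounded_linear])

text \<open>For y = X^T x, moving X^T across the inner product gives |y|^2 = x . (X y), which
  Cauchy-Schwarz bounds by |x| |X| |y|. Cancelling |y| finishes; the case y = 0 is
  immediate.\<close>

lemma spectral_norm_transpose_le:
  fixes X :: "real ^ 'm ^ 'n"
  shows "spectral_norm (transpose X) \<le> spectral_norm X"
proof (rule onorm_le)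
  fix x :: "real ^ 'n"
  let ?y = "transpose X *v x"
  have "norm ?y * norm ?y = x \<bullet> (X *v ?y)"
    by (metis dot_lmul_matrix norm_eq_square power2_eq_square power2_norm_eq_inner
        vector_transpose_matrix transpose_transpose)
  also have "\<dots> \<le> norm x * norm (X *v ?y)"
    by (rule norm_cauchy_schwarz)
  also have "\<dots> \<le> norm x * (spectral_norm X * norm ?y)"
    by (intro mult_left_mono onorm matrix_vector_mul_bounded_linear norm_ge_zero)
  finally have "norm ?y * norm ?y \<le> (spectral_norm X * norm x) * norm ?y"
    by (simp add: mult_ac)
  then show "norm ?y \<le> spectral_norm X * norm x"
    by (cases "norm ?y = 0") (auto simp: mult_le_cancel_right spectral_norm_nonneg)
qed

lemma matrix_diff_ldistrib:
  fixes X :: "real ^ 'm ^ 'n" and Y Z :: "real ^ 'k ^ 'm"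
  shows "X ** (Y - Z) = X ** Y - X ** Z"
  by (simp add: eq_diff_eq matrix_add_ldistrib[symmetric])

lemma matrix_diff_rdistrib:
  fixes X Y :: "real ^ 'm ^ 'n" and Z :: "real ^ 'k ^ 'm"
  shows "(X - Y) ** Z = X ** Z - Y ** Z"
  by (vector matrix_matrix_mult_def sum_subtractf left_diff_distrib)

lemma matrix_inv_mult:
  fixes X :: "real ^ 'n ^ 'n"
  assumes "invertible X"
  shows matrix_inv_right: "X ** matrix_inv X = mat 1"
    and matrix_inv_left: "matrix_inv X ** X = mat 1"
  using someI_ex[OF assms[unfolded invertible_def]] by (simp_all add: matrix_inv_def)

lemma matrix_mul_inv_cancel:
  fixes X :: "real ^ 'n ^ 'n" and Y :: "real ^ 'n ^ 'm"
  assumes "invertible X"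
  shows "Y ** X ** matrix_inv X = Y" and "Y ** matrix_inv X ** X = Y"
  by (simp_all add: matrix_inv_mult[OF assms] matrix_mul_assoc[symmetric])

text \<open>Everything rests on X - Y^-1 = Y^-1 (Y - X^-1) X, whose last two factors contribute at
  most \<open>e * b\<close>. Taking upper bounds \<open>b\<close> and \<open>e\<close> in place of
  exact norms lets one application feed its estimate to the next.\<close>

lemma inverse_perturbation_bound:
  fixes X Y :: "real ^ 'n ^ 'n"
  assumes X: "invertible X" and Y: "invertible Y"
    and b: "spectral_norm X \<le> b"
    and e: "spectral_norm (Y - matrix_inv X) \<le> e"
    and small: "e * b \<le> 1 / 2"
  shows "spectral_norm (X - matrix_inv Y) \<le> 2 * e * b\<^sup>2"
proof -
  let ?D = "matrix_inv Y" and ?E = "Y - matrix_inv X"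
  have "?D ** (?E ** X) = X - ?D"
    by (simp add: matrix_diff_ldistrib matrix_diff_rdistrib matrix_mul_assoc
        matrix_inv_mult[OF X] matrix_inv_mult[OF Y] matrix_mul_inv_cancel[OF X])
  then have d: "spectral_norm (X - ?D) \<le> spectral_norm ?D * spectral_norm (?E ** X)"
    using spectral_norm_mult[of ?D "?E ** X"] by simp
  have "0 \<le> e" "0 \<le> b"
    using b e spectral_norm_nonneg[of X] spectral_norm_nonneg[of ?E] by linarith+
  have "spectral_norm (?E ** X) \<le> e * b"
    using spectral_norm_mult[of ?E X] mult_mono[OF e b \<open>0 \<le> e\<close> spectral_norm_nonneg]
    by linarith
  then have d2: "spectral_norm (X - ?D) \<le> spectral_norm ?D * (e * b)"
    using d mult_left_mono[OF _ spectral_norm_nonneg[of ?D]] by (meson order_trans)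
  \<comment> \<open>No bound on Y^-1 is given, so its norm is absorbed: |Y^-1| is at most |Y^-1| / 2
    + b by \<open>small\<close>, hence at most 2b. This is the source of the factor 2 in the
    conclusion.\<close>
  have "spectral_norm ?D \<le> spectral_norm (X - ?D) + b"
    using spectral_norm_add[of "?D - X" X] spectral_norm_minus_commute[of X ?D] b by simp
  moreover have "spectral_norm ?D * (e * b) \<le> spectral_norm ?D * (1 / 2)"
    by (intro mult_left_mono small spectral_norm_nonneg)
  ultimately have "spectral_norm ?D \<le> 2 * b"
    using d2 by linarith
  then have "spectral_norm ?D * (e * b) \<le> 2 * b * (e * b)"
    using \<open>0 \<le> e\<close> \<open>0 \<le> b\<close> by (intro mult_right_mono) auto
  then show ?thesis
    using d2 by (simp add: power2_eq_square mult_ac)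
qed

text \<open>For square matrices a right inverse already forces invertibility, so an inverse can be
  identified by checking a single product.\<close>

lemma matrix_inv_unique_right:
  fixes X Y :: "real ^ 'n ^ 'n"
  assumes "X ** Y = mat 1"
  shows "matrix_inv X = Y"
proof -
  have "invertible X"
    using assms invertible_right_inverse by blast
  then have "matrix_inv X = matrix_inv X ** (X ** Y)"
    using assms by simp
  also have "\<dots> = Y"
    using \<open>invertible X\<close> by (simp add: matrix_mul_assoc matrix_inv_left)
  finally show ?thesis .
qed

lemma woodbury_inverse:
  fixes P :: "real ^ 'n ^ 'n" and Z :: "real ^ 'k ^ 'k"
    and U :: "real ^ 'k ^ 'n" and W :: "real ^ 'n ^ 'k"
  assumes P: "invertible P" and Z: "invertible Z"
    and M: "invertible (matrix_inv Z - W ** P ** U)"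
  shows "matrix_inv (P - P ** U ** Z ** W ** P)
    = matrix_inv P + U ** matrix_inv (matrix_inv Z - W ** P ** U) ** W"
proof (rule matrix_inv_unique_right)
  let ?N = "matrix_inv (matrix_inv Z - W ** P ** U)"
  \<comment> \<open>Expanding the product on the left turns this into \<open>N\<close>, the relation
    that makes the cross terms cancel below.\<close>
  have "Z ** (matrix_inv Z - W ** P ** U) ** ?N = Z"
    by (rule matrix_mul_inv_cancel(1)[OF M])
  then have N: "?N - Z ** W ** P ** U ** ?N = Z"
    by (simp add: matrix_diff_ldistrib matrix_diff_rdistrib matrix_mul_assoc matrix_inv_mult[OF Z])
  \<comment> \<open>The four terms are grouped so that the bracket equals Z by \<open>N\<close>;
    then P U Z W appears once with each sign and only P P^-1 survives.\<close>
  have "(P - P ** U ** Z ** W ** P) ** (matrix_inv P + U ** ?N ** W)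
    = P ** matrix_inv P - P ** U ** Z ** W ** (P ** matrix_inv P)
      + P ** U ** (?N - Z ** W ** P ** U ** ?N) ** W"
    by (simp add: matrix_diff_ldistrib matrix_diff_rdistrib matrix_add_ldistrib
        matrix_mul_assoc)
  also have "\<dots> = mat 1"
    unfolding N by (simp add: matrix_inv_mult[OF P])
  finally show "(P - P ** U ** Z ** W ** P) ** (matrix_inv P + U ** ?N ** W) = mat 1" .
qed

theorem mainTheorem2:
  fixes A B Atinv :: "real ^ 'n ^ 'n"
    and U V :: "real ^ 'k ^ 'n"
    and Zinv :: "real ^ 'k ^ 'k"
    and \<epsilon>\<^sub>1 \<epsilon>\<^sub>2 lam \<beta> :: real
  assumes "invertible A"
    and "rank U = CARD('k)" and "rank V = CARD('k)"
    and "invertible (mat 1 + transpose V ** matrix_inv A ** U)"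
    and "B = A + U ** transpose V"
    and "\<epsilon>\<^sub>1 = spectral_norm (Atinv - matrix_inv A)"
    and "invertible (mat 1 + transpose V ** Atinv ** U)"
    and "\<epsilon>\<^sub>2 = spectral_norm (Zinv - matrix_inv (mat 1 + transpose V ** Atinv ** U))"
    and "lam = spectral_norm U * spectral_norm V"
    and "spectral_norm (mat 1 + transpose V ** matrix_inv A ** U) \<le> \<beta>"
    and "invertible Atinv" and "invertible Zinv"
    and "invertible (matrix_inv Zinv - transpose V ** Atinv ** U)"
    and "\<epsilon>\<^sub>1 < 1 / (2 * spectral_norm A)"
    and "\<epsilon>\<^sub>2 < 1 / (2 * (\<beta> + lam * \<epsilon>\<^sub>1))"
    and "2 * (\<beta> + lam * \<epsilon>\<^sub>1)\<^sup>2 * \<epsilon>\<^sub>2 < 1 / 2"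
  shows "spectral_norm (B - matrix_inv (Atinv - Atinv ** U ** Zinv ** transpose V ** Atinv))
    \<le> 2 * \<epsilon>\<^sub>1 * (spectral_norm A)\<^sup>2 + 4 * lam * \<epsilon>\<^sub>2 * (\<beta> + lam * \<epsilon>\<^sub>1)\<^sup>2"
proof -
  define W where "W = transpose V"
  define b where "b = \<beta> + lam * \<epsilon>\<^sub>1"
  define S where "S = mat 1 + W ** Atinv ** U"
  define M where "M = matrix_inv Zinv - W ** Atinv ** U"
  have \<epsilon>: "0 \<le> \<epsilon>\<^sub>1" "0 \<le> \<epsilon>\<^sub>2"
    by (simp_all only: assms(6,8) spectral_norm_nonneg)
  have W: "spectral_norm W \<le> spectral_norm V"
    unfolding W_def by (rule spectral_norm_transpose_le)
  have sandwich: "spectral_norm (W ** X ** U) \<le> lam * spectral_norm X" for X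
  proof -
    have "spectral_norm (W ** X ** U) \<le> spectral_norm W * spectral_norm X * spectral_norm U"
      using spectral_norm_mult[of "W ** X" U]
        mult_right_mono[OF spectral_norm_mult[of W X] spectral_norm_nonneg[of U]] by linarith
    also have "\<dots> \<le> spectral_norm V * spectral_norm X * spectral_norm U"
      by (intro mult_right_mono W spectral_norm_nonneg)
    finally show ?thesis
      by (simp add: assms(9) mult_ac)
  qed
  have sandwich': "spectral_norm (U ** X ** W) \<le> lam * spectral_norm X" for X
  proof -
    have "spectral_norm (U ** X ** W) \<le> spectral_norm U * spectral_norm X * spectral_norm W"
      using spectral_norm_mult[of "U ** X" W]
        mult_right_mono[OF spectral_norm_mult[of U X] spectral_norm_nonneg[of W]] by linarith
    also have "\<dots> \<le> spectral_norm U * spectral_norm X * spectral_norm V"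
      by (intro mult_left_mono mult_nonneg_nonneg W spectral_norm_nonneg)
    finally show ?thesis
      by (simp add: assms(9) mult_ac)
  qed
  have A_bound: "spectral_norm (A - matrix_inv Atinv) \<le> 2 * \<epsilon>\<^sub>1 * (spectral_norm A)\<^sup>2"
  proof (rule inverse_perturbation_bound[OF assms(1,11) order_refl])
    \<comment> \<open>Division by zero yields 0, so if the norm of A vanished, assumption (iii)
      would read \<open>\<epsilon>\<^sub>1 < 0\<close>.\<close>
    have "0 < spectral_norm A"
      using assms(14) \<epsilon>(1) spectral_norm_nonneg[of A] by (cases "spectral_norm A = 0") auto
    then show "\<epsilon>\<^sub>1 * spectral_norm A \<le> 1 / 2"
      using assms(14) by (simp add: field_simps)
  qed (simp add: assms(6))
  have S_bound: "spectral_norm S \<le> b"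
  proof -
    \<comment> \<open>Replacing A^-1 by \<open>Atinv\<close> shifts the matrix bounded by \<beta> by
      a sandwiched error of norm at most \<open>lam * \<epsilon>\<^sub>1\<close>, which explains the
      choice of \<open>b\<close>.\<close>
    have "S = (mat 1 + W ** matrix_inv A ** U) + W ** (Atinv - matrix_inv A) ** U"
      by (simp add: S_def matrix_diff_ldistrib matrix_diff_rdistrib)
    then show ?thesis
      using spectral_norm_add[of "mat 1 + W ** matrix_inv A ** U" "W ** (Atinv - matrix_inv A) ** U"]
        sandwich[of "Atinv - matrix_inv A"] assms(6,10)
      by (simp add: b_def W_def)
  qed
  \<comment> \<open>\<open>S_bound\<close> gives b \<ge> 0, and b = 0 would turn (iv) into
    \<open>\<epsilon>\<^sub>2 < 0\<close>, again because 1 / 0 = 0.\<close>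
  have "0 < b"
    using assms(15) \<epsilon>(2) S_bound spectral_norm_nonneg[of S]
    by (cases "b = 0") (auto simp: b_def[symmetric])
  then have "\<epsilon>\<^sub>2 * b \<le> 1 / 2"
    using assms(15)[folded b_def] by (simp add: field_simps)
  then have "spectral_norm (S - matrix_inv Zinv) \<le> 2 * \<epsilon>\<^sub>2 * b\<^sup>2"
    using assms(7,8,12) S_bound
    by (intro inverse_perturbation_bound) (simp_all add: S_def W_def)
  moreover have "S - matrix_inv Zinv = mat 1 - M"
    by (simp add: S_def M_def)
  ultimately have M_bound: "spectral_norm (M - mat 1) \<le> 2 * \<epsilon>\<^sub>2 * b\<^sup>2"
    using spectral_norm_minus_commute[of M "mat 1"] by simp
  have inv1: "matrix_inv (mat 1) = (mat 1 :: real ^ 'k ^ 'k)"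
    by (rule matrix_inv_unique_right) simp
  \<comment> \<open>The perturbation bound is applied around the identity, with the bound just found
    for M - I as the error. Its smallness condition is exactly (v), and its factor 2 doubles the
    earlier one to the 4 of the theorem.\<close>
  have "spectral_norm (mat 1 - matrix_inv M) \<le> 2 * (2 * \<epsilon>\<^sub>2 * b\<^sup>2) * 1\<^sup>2"
  proof (rule inverse_perturbation_bound)
    show "invertible (mat 1 :: real ^ 'k ^ 'k)"
      unfolding invertible_def by (intro exI[of _ "mat 1"]) simp
    show "invertible M"
      using assms(13) by (simp add: M_def W_def)
    show "spectral_norm (mat 1 :: real ^ 'k ^ 'k) \<le> 1"
      by (rule onorm_le[of _ 1, simplified]) simp
    show "spectral_norm (M - matrix_inv (mat 1)) \<le> 2 * \<epsilon>\<^sub>2 * b\<^sup>2"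
      using M_bound by (simp add: inv1)
    show "2 * \<epsilon>\<^sub>2 * b\<^sup>2 * 1 \<le> 1 / 2"
      using assms(16) by (simp add: b_def mult_ac)
  qed
  then have "spectral_norm (U ** (mat 1 - matrix_inv M) ** W) \<le> lam * (4 * \<epsilon>\<^sub>2 * b\<^sup>2)"
    using sandwich'[of "mat 1 - matrix_inv M"]
      mult_left_mono[of "spectral_norm (mat 1 - matrix_inv M)" "4 * \<epsilon>\<^sub>2 * b\<^sup>2" lam]
    by (simp add: assms(9) spectral_norm_nonneg)
  \<comment> \<open>Both B and the Woodbury inverse have the form of a matrix plus U (...) W, with I
    and M^-1 in the middle, so the difference can be taken termwise.\<close>
  moreover have "B - matrix_inv (Atinv - Atinv ** U ** Zinv ** transpose V ** Atinv)
    = (A - matrix_inv Atinv) + U ** (mat 1 - matrix_inv M) ** W"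
    using woodbury_inverse[OF assms(11,12,13)]
    by (simp add: assms(5) M_def W_def matrix_diff_ldistrib matrix_diff_rdistrib)
  ultimately show ?thesis
    using A_bound
      spectral_norm_add[of "A - matrix_inv Atinv" "U ** (mat 1 - matrix_inv M) ** W"]
    by (simp add: b_def mult_ac)
qed

end
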